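(* Fix a deployment horizon of $T$ MPC updates $k=0,\dots,T-1$, and let $\mathcal F_k$ denote the closed-loop information available immediately before solving the CT-MPC problem at time $k$. Let the tube parameter be $\theta=\hat\theta_N$, with shift-compatible cross-sections and satisfying the terminal ingredients assumption (see context). Suppose that, on the calibration event $\mathcal G_N(\beta):=\{V_N\le\varepsilon_{N,s}(\beta)\}$, whenever the CT-MPC problem is feasible at update $k$, the horizon residual trajectory $\mathbf E_k$ at update $k$ satisfies $$\mathbb P\{\mathbf E_k\notin\mathcal E_{\hat\theta_N}\mid\mathcal F_k,S_N\}\le\varepsilon_{N,s}(\beta).$$ Then, on $\mathcal G_N(\beta)$, $$\mathbb P\{\text{some feasibility or horizon-safety failure in }T\text{ updates}\mid S_N\}\le T\,\varepsilon_{N,s}(\beta).$$ No independence between different MPC updates is required. Here a failure at update $k$ is the event that the CT-MPC problem is feasible at time $k$ and either (horizon-safety failure) some constraint $x_{t\mid k}\in\mathcal X$, $t=1,\dots,H$, or $u_{t\mid k}\in\mathcal U$, $t=0,\dots,H-1$, is violated by $x_{t\mid k}=z^\star_{t\mid k}+e_{t\mid k}$, $u_{t\mid k}=v^\star_{t\mid k}+Ke_{t\mid k}$, or (feasibility failure) the CT-MPC problem is infeasible at time $k+1$.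
   Context: System: $x_{k+1}=Ax_k+Bu_k+w_k$, $x_k\in\mathbb R^n$, $u_k\in\mathbb R^m$, $w_k$ random disturbance. $\mathcal X\subset\mathbb R^n$, $\mathcal U\subset\mathbb R^m$ are compact convex constraint sets with the origin in their interiors. $K$ is a fixed gain, $A_K:=A+BK$ (stable). With nominal dynamics $z_{t+1}=Az_t+Bv_t$, actual prediction $x_t=z_t+e_t$ and feedback $u_t=v_t+Ke_t$, the prediction error satisfies $e_{t+1}=A_Ke_t+w_t$, with $e_0=0$ at each MPC epoch (measured-state initialization $z_0=x_k$). At update $k$, $\mathbf E_k=(e_{1\mid k},\dots,e_{H\mid k})$ is the prediction-error trajectory started at time $k$, $e_{0\mid k}=0$. Tube: $\mathcal E_\theta\subseteq\mathbb R^{nH}$, $\theta\in\Theta$, measurable. Cross-sections: $\mathcal S_0=\{0\}$, and for $t=1,\dots,H$, $\mathcal S_t=\mathcal S_t(\theta)$ is the projection $\{e_t:\exists(e_1,\dots,e_H)\in\mathcal E_\theta\}$ of $\mathcal E_\theta$ onto its $t$-th block, taken compact and convex (or, if needed, replaced by a compact convex set containing that projection). $\oplus$ is Minkowski sum and $P\ominus Q:=\{a:a+Q\subseteq P\}$. Shift-compatible means $A_K^j\mathcal S_1\oplus\mathcal S_j\subseteq\mathcal S_{j+1}$ for $j=0,\dots,H-1$. CT-MPC problem at state $x$: minimize $\ell_f(z_H)+\sum_{t=0}^{H-1}\ell(z_t,v_t)$ over $(z_0,\dots,z_H)$, $(v_0,\dots,v_{H-1})$ subject to $z_0=x$; $z_{t+1}=Az_t+Bv_t$,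 $z_t\in\mathcal X\ominus\mathcal S_t$, $v_t\in\mathcal U\ominus K\mathcal S_t$ for $t=0,\dots,H-1$; and $z_H\in\mathcal X_f=\mathcal X_f(\theta)$. At each time $k$ it is solved at $x_k$, with optimal solution $(z^\star_{t\mid k}),(v^\star_{t\mid k})$, and $u_k=v^\star_{0\mid k}$ is applied, so that $e_{1\mid k}=x_{k+1}-z^\star_{1\mid k}=w_k$. Terminal ingredients assumption: $\mathcal X_f$ is compact and convex and there is a gain $K_f$ such that, with $A_f:=A+BK_f$: $\mathcal X_f\oplus\mathcal S_H\subseteq\mathcal X$; $\mathcal X_f\oplus A_K^{H-1}\mathcal S_1\subseteq\mathcal X\ominus\mathcal S_{H-1}$; $K_f(\mathcal X_f\oplus A_K^{H-1}\mathcal S_1)\subseteq\mathcal U\ominus K\mathcal S_{H-1}$; $A_f(\mathcal X_f\oplus A_K^{H-1}\mathcal S_1)\subseteq\mathcal X_f$; and moreover $\ell_f(A_fz)-\ell_f(z)\le-\ell(z,K_fz)$ for all $z\in\mathcal X_f$. $S_N=(\mathbf E^1,\dots,\mathbf E^N)$ is the calibration sample of residual trajectories in $\mathbb R^{nH}$, $\hat\theta_N$ the tube parameter computed from $S_N$, $V_N:=\mathbb P\{\mathbf E\notin\mathcal E_{\hat\theta_N}\mid S_N\}$ with $\mathbf E$ a fresh residual trajectory (i.i.d. with the calibration trajectories), $\beta\in(0,1)$, $s\in\{1,\dots,N\}$, $B_{N,s}(\varepsilon):=\sum_{j=0}^{s-1}\binom Nj\varepsilon^j(1-\varepsilon)^{N-j}$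 and $\varepsilon_{N,s}(\beta):=\inf\{\varepsilon\in[0,1]:B_{N,s}(\varepsilon)\le\beta\}$. *)

theory Defs
  imports "HOL-Probability.Probability" "HOL-Library.Set_Algebras"
begin

text \<open>
  The Minkowski sum of two sets is \<open>P + Q\<close> from \<open>HOL-Library.Set_Algebras\<close>.
\<close>

definition pontryagin_diff :: "'a::plus set \<Rightarrow> 'a set \<Rightarrow> 'a set"  (infixl "\<ominus>" 65) where
  "P \<ominus> Q = {a. (\<lambda>q. a + q) ` Q \<subseteq> P}"

definition mat_power :: "real^'n^'n \<Rightarrow> nat \<Rightarrow> real^'n^'n" where
  "mat_power M j = (((**) M) ^^ j) (mat 1)"

text \<open>Discrete-time stability: all complex eigenvalues lie in the open unit disc.\<close>

definition schur_stable :: "real^'n^'n \<Rightarrow> bool" where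
  "schur_stable M \<longleftrightarrow>
     (\<forall>(c::complex) v. v \<noteq> 0 \<and> (\<chi> i j. complex_of_real (M $ i $ j)) *v v = c *s v \<longrightarrow> norm c < 1)"

definition constraint_set :: "'a::euclidean_space set \<Rightarrow> bool" where
  "constraint_set P \<longleftrightarrow> compact P \<and> convex P \<and> 0 \<in> interior P"

text \<open>
  \<open>pred_err M w k t\<close> is the prediction error \<open>e\<^bsub>t|k\<^esub>\<close> of the epoch that starts at
  time \<open>k\<close>, driven by the disturbances \<open>w k, w (k + 1), \<dots>\<close>.
\<close>

primrec pred_err :: "real^'n^'n \<Rightarrow> (nat \<Rightarrow> real^'n) \<Rightarrow> nat \<Rightarrow> nat \<Rightarrow> real^'n" where
  "pred_err M w k 0 = 0"
| "pred_err M w k (Suc t) = M *v pred_err M w k t + w (k + t)"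

text \<open>
  Elements of \<open>\<real>\<^bsup>nH\<^esup>\<close> are extensional functions on the block index set \<open>{1..H}\<close>.
\<close>

definition traj_space :: "nat \<Rightarrow> (nat \<Rightarrow> real^'n) measure" where
  "traj_space H = (\<Pi>\<^sub>M t\<in>{1..H}. borel)"

text \<open>
  A cross-section may be the projection of the tube itself or any compact convex superset of it.
\<close>

definition cross_sections :: "nat \<Rightarrow> (nat \<Rightarrow> real^'n) set \<Rightarrow> (nat \<Rightarrow> (real^'n) set) \<Rightarrow> bool" where
  "cross_sections H E S \<longleftrightarrow> S 0 = {0} \<and>
     (\<forall>t\<in>{1..H}. compact (S t) \<and> convex (S t) \<and> (\<lambda>e. e t) ` E \<subseteq> S t)"

definition shift_compatible :: "real^'n^'n \<Rightarrow> nat \<Rightarrow> (nat \<Rightarrow> (real^'n) set) \<Rightarrow> bool" where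
  "shift_compatible M H S \<longleftrightarrow> (\<forall>j<H. (*v) (mat_power M j) ` S 1 + S j \<subseteq> S (Suc j))"

text \<open>
  Only \<open>z 0, \<dots>, z H\<close> and \<open>v 0, \<dots>, v (H - 1)\<close> are constrained and enter the cost; the other
  values of the two functions are irrelevant.
\<close>

definition mpc_admissible ::
  "real^'n^'n \<Rightarrow> real^'m^'n \<Rightarrow> real^'n^'m \<Rightarrow> (real^'n) set \<Rightarrow> (real^'m) set \<Rightarrow> nat \<Rightarrow>
   (nat \<Rightarrow> (real^'n) set) \<Rightarrow> (real^'n) set \<Rightarrow> real^'n \<Rightarrow> (nat \<Rightarrow> real^'n) \<Rightarrow> (nat \<Rightarrow> real^'m) \<Rightarrow> bool" where
  "mpc_admissible A B K X U H S Xf x z v \<longleftrightarrow>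
     z 0 = x \<and>
     (\<forall>t<H. z (Suc t) = A *v z t + B *v v t \<and> z t \<in> X \<ominus> S t \<and> v t \<in> U \<ominus> ((*v) K ` S t)) \<and>
     z H \<in> Xf"

definition mpc_cost ::
  "nat \<Rightarrow> (real^'n \<Rightarrow> real^'m \<Rightarrow> real) \<Rightarrow> (real^'n \<Rightarrow> real) \<Rightarrow> (nat \<Rightarrow> real^'n) \<Rightarrow> (nat \<Rightarrow> real^'m) \<Rightarrow> real" where
  "mpc_cost H l lf z v = lf (z H) + (\<Sum>t<H. l (z t) (v t))"

definition mpc_feasible ::
  "real^'n^'n \<Rightarrow> real^'m^'n \<Rightarrow> real^'n^'m \<Rightarrow> (real^'n) set \<Rightarrow> (real^'m) set \<Rightarrow> nat \<Rightarrow>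
   (nat \<Rightarrow> (real^'n) set) \<Rightarrow> (real^'n) set \<Rightarrow> real^'n \<Rightarrow> bool" where
  "mpc_feasible A B K X U H S Xf x \<longleftrightarrow> (\<exists>z v. mpc_admissible A B K X U H S Xf x z v)"

definition mpc_optimal ::
  "real^'n^'n \<Rightarrow> real^'m^'n \<Rightarrow> real^'n^'m \<Rightarrow> (real^'n) set \<Rightarrow> (real^'m) set \<Rightarrow> nat \<Rightarrow>
   (nat \<Rightarrow> (real^'n) set) \<Rightarrow> (real^'n) set \<Rightarrow> (real^'n \<Rightarrow> real^'m \<Rightarrow> real) \<Rightarrow> (real^'n \<Rightarrow> real) \<Rightarrow>
   real^'n \<Rightarrow> (nat \<Rightarrow> real^'n) \<Rightarrow> (nat \<Rightarrow> real^'m) \<Rightarrow> bool" where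
  "mpc_optimal A B K X U H S Xf l lf x z v \<longleftrightarrow>
     mpc_admissible A B K X U H S Xf x z v \<and>
     (\<forall>z' v'. mpc_admissible A B K X U H S Xf x z' v' \<longrightarrow> mpc_cost H l lf z v \<le> mpc_cost H l lf z' v')"

definition terminal_ingredients ::
  "real^'n^'n \<Rightarrow> real^'m^'n \<Rightarrow> real^'n^'m \<Rightarrow> (real^'n) set \<Rightarrow> (real^'m) set \<Rightarrow> nat \<Rightarrow>
   (nat \<Rightarrow> (real^'n) set) \<Rightarrow> (real^'n) set \<Rightarrow> (real^'n \<Rightarrow> real^'m \<Rightarrow> real) \<Rightarrow> (real^'n \<Rightarrow> real) \<Rightarrow> bool" where
  "terminal_ingredients A B K X U H S Xf l lf \<longleftrightarrow>
     compact Xf \<and> convex Xf \<and>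
     (\<exists>Kf :: real^'n^'m.
        let Af = A + B ** Kf;
            R = Xf + (*v) (mat_power (A + B ** K) (H - 1)) ` S 1
        in Xf + S H \<subseteq> X \<and>
           R \<subseteq> X \<ominus> S (H - 1) \<and>
           (*v) Kf ` R \<subseteq> U \<ominus> ((*v) K ` S (H - 1)) \<and>
           (*v) Af ` R \<subseteq> Xf \<and>
           (\<forall>z\<in>Xf. lf (Af *v z) - lf z \<le> - l z (Kf *v z)))"

definition horizon_safe ::
  "real^'n^'m \<Rightarrow> (real^'n) set \<Rightarrow> (real^'m) set \<Rightarrow> nat \<Rightarrow>
   (nat \<Rightarrow> real^'n) \<Rightarrow> (nat \<Rightarrow> real^'m) \<Rightarrow> (nat \<Rightarrow> real^'n) \<Rightarrow> bool" where
  "horizon_safe K X U H z v e \<longleftrightarrow>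
     (\<forall>t\<in>{1..H}. z t + e t \<in> X) \<and> (\<forall>t<H. v t + K *v e t \<in> U)"

definition binom_tail :: "nat \<Rightarrow> nat \<Rightarrow> real \<Rightarrow> real" where
  "binom_tail N s \<epsilon> = (\<Sum>j<s. real (N choose j) * \<epsilon> ^ j * (1 - \<epsilon>) ^ (N - j))"

definition calib_eps :: "nat \<Rightarrow> nat \<Rightarrow> real \<Rightarrow> real" where
  "calib_eps N s \<beta> = Inf {\<epsilon> \<in> {0..1}. binom_tail N s \<epsilon> \<le> \<beta>}"

definition cond_probability :: "'w measure \<Rightarrow> 'w measure \<Rightarrow> ('w \<Rightarrow> bool) \<Rightarrow> 'w \<Rightarrow> real" where
  "cond_probability M G P = real_cond_exp M G (indicator {\<omega> \<in> space M. P \<omega>})"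

definition join_algebra :: "'w measure \<Rightarrow> 'w measure \<Rightarrow> 'w measure" where
  "join_algebra F G = sigma (space F) (sets F \<union> sets G)"

end

theory Submission
  imports Defs
begin

text \<open>
  If the residual trajectory of a feasible update stays in the tube, the tightened constraints give
  horizon safety, and shifting the optimal plan by one step, correcting it by \<open>A\<^sub>K\<^sup>t w\<close> and appending
  the terminal control law gives a feasible plan for the next update. So a failure at update \<open>k\<close>
  implies that the problem is feasible and \<open>\<^bold>E\<^sub>k\<close> leaves the tube. The coverage
  bound, integrated over \<open>\<F>\<^sub>k\<close> by the tower property, bounds the conditional probability of each
  failure, and the union bound over the updates concludes.
\<close>

section \<open>Constraint tightening and recursive feasibility\<close>

lemma mem_pontryagin_diff: "a \<in> P \<ominus> Q \<longleftrightarrow> (\<forall>q\<in>Q. a + q \<in> P)"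
  by (auto simp: pontryagin_diff_def)

lemma mat_power_Suc_mult_vector: "mat_power M (Suc j) *v a = M *v (mat_power M j *v a)"
  by (simp add: mat_power_def matrix_vector_mul_assoc)

text \<open>For \<open>t < H\<close> the tightened sets absorb any error in \<open>S t\<close>. The
  terminal state has no tightened constraint of this kind, so at \<open>t = H\<close> the inclusion
  \<open>Xf + S H \<subseteq> X\<close> takes over.\<close>

lemma horizon_safe_if_in_sections:
  assumes adm: "mpc_admissible A B K X U H S Xf x z v"
    and ter: "terminal_ingredients A B K X U H S Xf l lf"
    and err: "\<And>t. t \<le> H \<Longrightarrow> e t \<in> S t"
  shows "horizon_safe K X U H z v e"
proof -
  have "z t + e t \<in> X" if "t \<in> {1..H}" for t
  proof (cases "t < H")
    case True
    then show ?thesis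
      using adm err[of t] by (auto simp: mpc_admissible_def mem_pontryagin_diff)
  next
    case False
    then have "t = H" using that by auto
    moreover have "Xf + S H \<subseteq> X" "z H \<in> Xf"
      using ter adm by (auto simp: terminal_ingredients_def Let_def mpc_admissible_def)
    ultimately show ?thesis using err[of H] by (auto intro: set_plus_intro)
  qed
  moreover have "v t + K *v e t \<in> U" if "t < H" for t
    using adm err[of t] that by (auto simp: mpc_admissible_def mem_pontryagin_diff)
  ultimately show ?thesis by (simp add: horizon_safe_def)
qed

text \<open>By shift compatibility, the correction at step \<open>t\<close> plus an error in
  \<open>S t\<close> lies in \<open>S (Suc t)\<close>, the margin that the old plan kept at
  \<open>Suc t\<close>. The shifted and corrected plan therefore retains the margin
  \<open>S t\<close>; only its last step relies on the terminal gain.\<close>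

lemma mpc_feasible_shift:
  fixes A :: "real^'n^'n" and B :: "real^'m^'n" and K :: "real^'n^'m"
  assumes H: "1 \<le> H"
    and adm: "mpc_admissible A B K X U H S Xf x z v"
    and ter: "terminal_ingredients A B K X U H S Xf l lf"
    and shift: "shift_compatible (A + B ** K) H S"
    and w: "w \<in> S 1"
  shows "mpc_feasible A B K X U H S Xf (z 1 + w)"
proof -
  \<comment> \<open>\<open>P j\<close> is the realized disturbance after \<open>j\<close> steps of
    the error dynamics.\<close>
  define P where "P j = mat_power (A + B ** K) j *v w" for j
  have P0: "P 0 = w" by (simp add: P_def mat_power_def)
  \<comment> \<open>Splitting \<open>A + B ** K\<close> exhibits \<open>P\<close> as a nominal
    trajectory with input \<open>K *v P j\<close>, so adding it to the shifted plan preserves the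
    nominal dynamics.\<close>
  have PSuc: "P (Suc j) = A *v P j + B *v (K *v P j)" for j
    by (simp add: P_def mat_power_Suc_mult_vector matrix_vector_mult_add_rdistrib
        flip: matrix_vector_mul_assoc)
  have PS: "P j + q \<in> S (Suc j)" if "j < H" "q \<in> S j" for j q
    using shift w that unfolding shift_compatible_def P_def by (auto intro!: set_plus_intro)
  obtain Kf where
    R: "Xf + (*v) (mat_power (A + B ** K) (H - 1)) ` S 1 \<subseteq> X \<ominus> S (H - 1)"
       "(*v) Kf ` (Xf + (*v) (mat_power (A + B ** K) (H - 1)) ` S 1) \<subseteq> U \<ominus> ((*v) K ` S (H - 1))"
       "(*v) (A + B ** Kf) ` (Xf + (*v) (mat_power (A + B ** K) (H - 1)) ` S 1) \<subseteq> Xf"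
    using ter by (auto simp: terminal_ingredients_def Let_def)
  \<comment> \<open>\<open>r\<close> is the state of the new plan at \<open>H - 1\<close>. The new
    state departs from the shifted plan only at \<open>H\<close>, but the new input already at
    \<open>H - 1\<close>, where no old input is left; hence \<open>t < H\<close> in
    \<open>z'\<close> against \<open>Suc t < H\<close> in \<open>v'\<close>.\<close>
  define r where "r = z H + P (H - 1)"
  define z' where "z' t = (if t < H then z (Suc t) + P t else (A + B ** Kf) *v r)" for t
  define v' where "v' t = (if Suc t < H then v (Suc t) + K *v P t else Kf *v r)" for t
  have "z H \<in> Xf" using adm by (simp add: mpc_admissible_def)
  then have r: "r \<in> Xf + (*v) (mat_power (A + B ** K) (H - 1)) ` S 1"
    unfolding r_def P_def using w by (intro set_plus_intro) auto
  have step: "z (Suc t) = A *v z t + B *v v t" "z t \<in> X \<ominus> S t" "v t \<in> U \<ominus> ((*v) K ` S t)"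
    if "t < H" for t using adm that by (auto simp: mpc_admissible_def)
  have "z' (Suc t) = A *v z' t + B *v v' t \<and> z' t \<in> X \<ominus> S t \<and> v' t \<in> U \<ominus> ((*v) K ` S t)"
    if t: "t < H" for t
  proof (cases "Suc t < H")
    case True
    \<comment> \<open>The old constraint at \<open>Suc t\<close> is used with the error
      \<open>P t + q\<close> for \<open>q\<close> in \<open>S t\<close>; reassociating the sum gives
      the constraint at \<open>t\<close>.\<close>
    have "z' t \<in> X \<ominus> S t"
      using step(2)[OF True] PS[OF t] t
      by (auto simp: z'_def mem_pontryagin_diff add.assoc)
    moreover have "v' t \<in> U \<ominus> ((*v) K ` S t)"
      using step(3)[OF True] PS[OF t] True
      by (auto simp: v'_def mem_pontryagin_diff add.assoc simp flip: matrix_vector_right_distrib)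
    moreover have "z' (Suc t) = A *v z' t + B *v v' t"
      using True t step(1)[OF True]
      by (simp add: z'_def v'_def PSuc matrix_vector_right_distrib algebra_simps)
    ultimately show ?thesis by blast
  next
    case False
    then have tH: "t = H - 1" "Suc t = H" using t by auto
    have z't: "z' t = r" using tH t by (simp add: z'_def r_def)
    \<comment> \<open>Here the state is \<open>r\<close>, so both tightened constraints are terminal
      inclusions, and the successor is the terminal closed loop applied to \<open>r\<close>.\<close>
    show ?thesis
      using R(1,2) r z't tH
      by (auto simp: z'_def v'_def matrix_vector_mult_add_rdistrib simp flip: matrix_vector_mul_assoc)
  qed
  moreover have "z' H \<in> Xf" using R(3) r by (auto simp: z'_def)
  moreover have "z' 0 = z 1 + w" using H by (simp add: z'_def P0)
  ultimately show ?thesis unfolding mpc_feasible_def mpc_admissible_def by blast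
qed

section \<open>Measurability of the horizon-safety event\<close>

lemma borel_measurable_matrix_vector_mult [measurable (raw)]:
  fixes C :: "real^'n^'m"
  assumes "f \<in> borel_measurable M"
  shows "(\<lambda>\<omega>. C *v f \<omega>) \<in> borel_measurable M"
  by (rule measurable_compose[OF assms])
    (intro borel_measurable_continuous_onI matrix_vector_mult_linear_continuous_on)

lemma borel_measurable_pred_err:
  assumes [measurable]: "\<And>k. w k \<in> borel_measurable M"
  shows "(\<lambda>\<omega>. pred_err C (\<lambda>j. w j \<omega>) k t) \<in> borel_measurable M"
  by (induction t) simp_all

text \<open>Compact constraint sets are closed, hence Borel, and only finitely many time indices are
  involved.\<close>

lemma sets_horizon_safe:
  assumes "constraint_set X" "constraint_set U"
    and z: "\<And>t. t \<le> H \<Longrightarrow> z t \<in> borel_measurable M"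
    and v: "\<And>t. t < H \<Longrightarrow> v t \<in> borel_measurable M"
    and e: "\<And>t. e t \<in> borel_measurable M"
  shows "{\<omega> \<in> space M. horizon_safe K X U H (\<lambda>t. z t \<omega>) (\<lambda>t. v t \<omega>) (\<lambda>t. e t \<omega>)} \<in> sets M"
proof -
  have XU: "X \<in> sets borel" "U \<in> sets borel"
    using assms(1,2) by (auto simp: constraint_set_def intro: borel_closed compact_imp_closed)
  have "{\<omega> \<in> space M. z t \<omega> + e t \<omega> \<in> X} \<in> sets M" if "t \<in> {1..H}" for t
  proof -
    have [measurable]: "z t \<in> borel_measurable M" "e t \<in> borel_measurable M"
      using z e that by auto
    show ?thesis using XU by measurable
  qed
  moreover have "{\<omega> \<in> space M. v t \<omega> + K *v e t \<omega> \<in> U} \<in> sets M" if "t < H" for t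
  proof -
    have [measurable]: "v t \<in> borel_measurable M" "e t \<in> borel_measurable M"
      using v e that by auto
    show ?thesis using XU by measurable
  qed
  ultimately show ?thesis
    unfolding horizon_safe_def
    by (intro sets.sets_Collect_conj sets.sets_Collect_finite_All) auto
qed

section \<open>The calibrated level and conditional probabilities over nested sub-algebras\<close>

lemma calib_eps_nonneg:
  assumes "s \<in> {1..N}" "0 < \<beta>"
  shows "0 \<le> calib_eps N s \<beta>"
proof -
  \<comment> \<open>Since \<open>j < s\<close> and \<open>s \<le> N\<close>, every term contains
    \<open>0 ^ (N - j)\<close> with a positive exponent. So 1 belongs to the set under
    \<open>Inf\<close>, which is therefore nonempty.\<close>
  have "binom_tail N s 1 = 0"
    unfolding binom_tail_def using assms(1) by (intro sum.neutral) (auto simp: power_0_left)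
  then have "1 \<in> {\<epsilon> \<in> {0..1}. binom_tail N s \<epsilon> \<le> \<beta>}" using assms(2) by auto
  then show ?thesis unfolding calib_eps_def by (intro cInf_greatest) auto
qed

text \<open>These inclusions let the tower property pass from conditioning on \<open>F\<close> and
  \<open>G\<close> jointly to conditioning on \<open>G\<close> alone.\<close>

lemma
  assumes F: "subalgebra M F" and G: "subalgebra M G"
  shows subalgebra_join: "subalgebra M (join_algebra F G)"
    and subalgebra_join_right: "subalgebra (join_algebra F G) G"
proof -
  have sp: "space F = space M" "space G = space M" and st: "sets F \<subseteq> sets M" "sets G \<subseteq> sets M"
    using F G by (auto simp: subalgebra_def)
  have Pow: "sets F \<union> sets G \<subseteq> Pow (space F)"
    using sets.space_closed[of F] sets.space_closed[of G] sp by auto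
  have "sets (join_algebra F G) = sigma_sets (space M) (sets F \<union> sets G)"
    using Pow sp by (simp add: join_algebra_def)
  moreover have "space (join_algebra F G) = space M"
    using Pow sp by (simp add: join_algebra_def space_measure_of)
  moreover have "sigma_sets (space M) (sets F \<union> sets G) \<subseteq> sets M"
    using st by (intro sets.sigma_sets_subset) simp
  ultimately show "subalgebra M (join_algebra F G)" "subalgebra (join_algebra F G) G"
    using sp by (auto simp: subalgebra_def)
qed

text \<open>
  The event \<open>W\<close> need not be measurable with respect to \<open>G\<close>: it is contained, up to a null
  set, in the \<open>G\<close>-measurable event on which the conditional probability of \<open>Bad\<close> is at most \<open>\<epsilon>\<close>.
\<close>

lemma (in prob_space) real_cond_exp_indicator_le:
  assumes G: "subalgebra M G" and G0: "subalgebra G G0"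
    and Bad: "Bad \<in> events" and Fail: "Fail \<in> events" "Fail \<subseteq> Bad \<inter> W"
    and Q: "{\<omega> \<in> space M. Q \<omega>} \<in> sets G0"
    and eps: "0 \<le> (\<epsilon>::real)"
    and bound: "AE \<omega> in M. Q \<omega> \<longrightarrow> \<omega> \<in> W \<longrightarrow> real_cond_exp M G (indicator Bad) \<omega> \<le> \<epsilon>"
  shows "AE \<omega> in M. Q \<omega> \<longrightarrow> real_cond_exp M G0 (indicator Fail) \<omega> \<le> \<epsilon>"
proof -
  have G0M: "subalgebra M G0" using G G0 by (auto simp: subalgebra_def)
  interpret G: finite_measure_subalgebra M G
    using G by unfold_locales
  interpret G0: finite_measure_subalgebra M G0
    using G0M by unfold_locales
  define g where "g = real_cond_exp M G (indicator Bad)"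
  define C where "C = {\<omega> \<in> space M. g \<omega> \<le> \<epsilon>}"
  define D where "D = {\<omega> \<in> space M. Q \<omega>}"
  have spG: "space G = space M" using G by (simp add: subalgebra_def)
  have gG: "g \<in> borel_measurable G" by (simp add: g_def)
  have CG: "C \<in> sets G" using gG unfolding C_def spG[symmetric] by measurable
  have CM: "C \<in> events" using CG G by (auto simp: subalgebra_def)
  have DM: "D \<in> events" and DG0: "D \<in> sets G0" using Q G0M by (auto simp: D_def subalgebra_def)
  note [measurable] = Bad Fail(1) CM DM
  have int_ind: "integrable M (\<lambda>\<omega>. indicator S \<omega> * indicator S' \<omega> :: real)"
    if "S \<in> events" "S' \<in> events" for S S'
    using that by (intro integrable_const_bound[of _ 1]) (auto simp: indicator_def)
  \<comment> \<open>\<open>D\<close> is \<open>G0\<close>-measurable, so its indicator factors out;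
    this localizes the estimate to \<open>Q\<close>.\<close>
  have 1: "AE \<omega> in M. real_cond_exp M G0 (\<lambda>\<omega>. indicator D \<omega> * indicator Fail \<omega>) \<omega>
      = indicator D \<omega> * real_cond_exp M G0 (indicator Fail) \<omega>"
    using DG0 by (intro G0.real_cond_exp_mult int_ind) auto
  \<comment> \<open>A point of \<open>D\<close> and \<open>Fail\<close> lies in \<open>W\<close> and
    \<open>Bad\<close>, so outside a null set \<open>bound\<close> puts it in
    \<open>C\<close>.\<close>
  have 2: "AE \<omega> in M. real_cond_exp M G0 (\<lambda>\<omega>. indicator D \<omega> * indicator Fail \<omega>) \<omega>
      \<le> real_cond_exp M G0 (\<lambda>\<omega>. indicator C \<omega> * indicator Bad \<omega>) \<omega>"
  proof (intro G0.real_cond_exp_mono int_ind)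
    show "AE \<omega> in M. indicator D \<omega> * indicator Fail \<omega> \<le> (indicator C \<omega> * indicator Bad \<omega> :: real)"
      using bound
    proof eventually_elim
      case (elim \<omega>)
      then show ?case using Fail(2) by (auto simp: C_def D_def g_def indicator_def)
    qed
  qed auto
  \<comment> \<open>Factoring out the \<open>G\<close>-measurable \<open>C\<close> leaves
    \<open>indicator C \<omega> * g \<omega>\<close>. Off \<open>C\<close> this is 0, which is where
    \<open>0 \<le> \<epsilon>\<close> enters.\<close>
  have 3: "AE \<omega> in M. real_cond_exp M G (\<lambda>\<omega>. indicator C \<omega> * indicator Bad \<omega>) \<omega> \<le> \<epsilon>"
  proof -
    have "AE \<omega> in M. real_cond_exp M G (\<lambda>\<omega>. indicator C \<omega> * indicator Bad \<omega>) \<omega> = indicator C \<omega> * g \<omega>"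
      unfolding g_def using CG by (intro G.real_cond_exp_mult int_ind) auto
    then show ?thesis
      by eventually_elim (use eps in \<open>auto simp: C_def indicator_def\<close>)
  qed
  have 4: "AE \<omega> in M. real_cond_exp M G0 (real_cond_exp M G (\<lambda>\<omega>. indicator C \<omega> * indicator Bad \<omega>)) \<omega>
      \<le> real_cond_exp M G0 (\<lambda>_. \<epsilon>) \<omega>"
    using 3 by (intro G0.real_cond_exp_mono G.real_cond_exp_int(1) int_ind) auto
  have 5: "AE \<omega> in M. real_cond_exp M G0 (\<lambda>_. \<epsilon>) \<omega> = \<epsilon>"
    by (intro G0.real_cond_exp_F_meas) auto
  \<comment> \<open>Tower property: the finer conditioning on \<open>G\<close> is absorbed by the
    coarser one on \<open>G0\<close>.\<close>
  have 6: "AE \<omega> in M. real_cond_exp M G0 (real_cond_exp M G (\<lambda>\<omega>. indicator C \<omega> * indicator Bad \<omega>)) \<omega>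
      = real_cond_exp M G0 (\<lambda>\<omega>. indicator C \<omega> * indicator Bad \<omega>) \<omega>"
    using G G0 by (intro G0.real_cond_exp_nested_subalg int_ind) auto
  from 1 2 4 5 6 AE_space show ?thesis
    by eventually_elim (auto simp: D_def indicator_def)
qed

text \<open>The indicator of a union is at most the sum of the indicators, and conditional
  expectation is monotone and additive however the events depend on each other.\<close>

lemma (in prob_space) real_cond_exp_indicator_Union_le:
  assumes G: "subalgebra M G"
    and Fail: "\<And>k. k < T \<Longrightarrow> Fail k \<in> events"
    and bound: "\<And>k. k < T \<Longrightarrow>
      AE \<omega> in M. Q \<omega> \<longrightarrow> real_cond_exp M G (indicator (Fail k)) \<omega> \<le> \<epsilon>"
  shows "AE \<omega> in M. Q \<omega> \<longrightarrow>
    real_cond_exp M G (indicator (\<Union>k<T. Fail k)) \<omega> \<le> real T * \<epsilon>"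
proof -
  interpret G: finite_measure_subalgebra M G
    using G by unfold_locales
  (* real_cond_exp_sum asks for integrability at all indices, so truncate beyond T. *)
  define F' where "F' k = (if k < T then Fail k else {})" for k
  have [measurable]: "F' k \<in> events" for k using Fail by (auto simp: F'_def)
  have eq: "(\<Union>k<T. Fail k) = (\<Union>k<T. F' k)" by (auto simp: F'_def)
  have int: "integrable M (indicator (F' k) :: _ \<Rightarrow> real)" for k
    by (intro integrable_const_bound[of _ 1]) (auto simp: indicator_def)
  have le: "indicator (\<Union>k<T. F' k) \<omega> \<le> (\<Sum>k<T. indicator (F' k) \<omega> :: real)" for \<omega>
  proof (cases "\<exists>k<T. \<omega> \<in> F' k")
    case True
    then obtain k where "k < T" "\<omega> \<in> F' k" by blast
    then have "1 \<le> (\<Sum>k<T. indicator (F' k) \<omega> :: real)"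
      using member_le_sum[of k "{..<T}" "\<lambda>k. indicator (F' k) \<omega> :: real"] by auto
    then show ?thesis by (auto simp: indicator_def)
  qed (auto simp: sum_nonneg)
  have "AE \<omega> in M. real_cond_exp M G (indicator (\<Union>k<T. F' k)) \<omega>
      \<le> real_cond_exp M G (\<lambda>\<omega>. \<Sum>k<T. indicator (F' k) \<omega>) \<omega>"
  proof (intro G.real_cond_exp_mono AE_I2)
    show "integrable M (indicator (\<Union>k<T. F' k) :: _ \<Rightarrow> real)"
      by (intro integrable_const_bound[of _ 1]) (auto simp: indicator_def)
  qed (use le int in auto)
  moreover have "AE \<omega> in M. real_cond_exp M G (\<lambda>\<omega>. \<Sum>k<T. indicator (F' k) \<omega>) \<omega>
      = (\<Sum>k<T. real_cond_exp M G (indicator (F' k)) \<omega>)"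
    using int by (intro G.real_cond_exp_sum)
  \<comment> \<open>Finitely many null sets merge into one, so the bounds hold for all
    \<open>k\<close> at the same sample point.\<close>
  moreover have "AE \<omega> in M. \<forall>k\<in>{..<T}. Q \<omega> \<longrightarrow> real_cond_exp M G (indicator (F' k)) \<omega> \<le> \<epsilon>"
    using bound by (intro AE_finite_allI) (auto simp: F'_def)
  ultimately show ?thesis
    unfolding eq
  proof eventually_elim
    case (elim \<omega>)
    show ?case
    proof
      assume "Q \<omega>"
      then have "(\<Sum>k<T. real_cond_exp M G (indicator (F' k)) \<omega>) \<le> of_nat (card {..<T}) * \<epsilon>"
        using elim(3) by (intro sum_bounded_above) auto
      then show "real_cond_exp M G (indicator (\<Union>k<T. F' k)) \<omega> \<le> real T * \<epsilon>"
        using elim(1,2) by simp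
    qed
  qed
qed

section \<open>The closed-loop guarantee over all updates\<close>

theorem corollary12:
  fixes A :: "real^'n^'n" and B :: "real^'m^'n" and K :: "real^'n^'m"
    and X :: "(real^'n) set" and U :: "(real^'m) set"
    and l :: "real^'n \<Rightarrow> real^'m \<Rightarrow> real" and lf :: "real^'n \<Rightarrow> real"
    and H N s T :: nat and \<beta> :: real
    and \<Theta> :: "'p measure" and Tube :: "'p \<Rightarrow> (nat \<Rightarrow> real^'n) set"
    and Sec :: "'p \<Rightarrow> nat \<Rightarrow> (real^'n) set" and Xf :: "'p \<Rightarrow> (real^'n) set"
    and calibrate :: "(nat \<Rightarrow> nat \<Rightarrow> real^'n) \<Rightarrow> 'p"
    and M :: "'w measure" and F :: "nat \<Rightarrow> 'w measure"
    and D :: "nat \<Rightarrow> 'w \<Rightarrow> nat \<Rightarrow> real^'n" and Efresh :: "'w \<Rightarrow> nat \<Rightarrow> real^'n"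
    and SN :: "'w \<Rightarrow> nat \<Rightarrow> nat \<Rightarrow> real^'n" and \<sigma>SN :: "'w measure"
    and \<theta>hat :: "'w \<Rightarrow> 'p" and V :: "'w \<Rightarrow> real"
    and x w :: "nat \<Rightarrow> 'w \<Rightarrow> real^'n" and u :: "nat \<Rightarrow> 'w \<Rightarrow> real^'m"
    and zs :: "nat \<Rightarrow> nat \<Rightarrow> 'w \<Rightarrow> real^'n" and vs :: "nat \<Rightarrow> nat \<Rightarrow> 'w \<Rightarrow> real^'m"
    and e :: "nat \<Rightarrow> nat \<Rightarrow> 'w \<Rightarrow> real^'n" and E :: "nat \<Rightarrow> 'w \<Rightarrow> nat \<Rightarrow> real^'n"
    and feasible failure :: "nat \<Rightarrow> 'w \<Rightarrow> bool"
  assumes M: "prob_space M"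
    and H: "1 \<le> H" and s: "s \<in> {1..N}" and \<beta>: "0 < \<beta>" "\<beta> < 1"
    and X: "constraint_set X" and U: "constraint_set U"
    and stable: "schur_stable (A + B ** K)"
    and Tube_subset: "\<And>\<theta>. \<theta> \<in> space \<Theta> \<Longrightarrow> Tube \<theta> \<subseteq> space (traj_space H)"
    and Tube_measurable:
      "{(\<theta>, \<xi>) \<in> space (\<Theta> \<Otimes>\<^sub>M traj_space H). \<xi> \<in> Tube \<theta>} \<in> sets (\<Theta> \<Otimes>\<^sub>M traj_space H)"
    and iid: "prob_space.indep_vars M (\<lambda>_. traj_space H) (\<lambda>i. if i = 0 then Efresh else D i) {0..N}"
      "\<And>i. i \<in> {1..N} \<Longrightarrow> distr M (traj_space H) (D i) = distr M (traj_space H) Efresh"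
    and SN: "\<And>\<omega>. SN \<omega> = (\<lambda>i\<in>{1..N}. D i \<omega>)"
    and \<sigma>SN: "\<sigma>SN = vimage_algebra (space M) SN (\<Pi>\<^sub>M i\<in>{1..N}. traj_space H)"
    and calibrate: "calibrate \<in> (\<Pi>\<^sub>M i\<in>{1..N}. traj_space H) \<rightarrow>\<^sub>M \<Theta>"
    and \<theta>hat: "\<And>\<omega>. \<theta>hat \<omega> = calibrate (SN \<omega>)"
    and V: "V = cond_probability M \<sigma>SN (\<lambda>\<omega>. Efresh \<omega> \<notin> Tube (\<theta>hat \<omega>))"
    and sections: "\<And>\<omega>. \<omega> \<in> space M \<Longrightarrow> cross_sections H (Tube (\<theta>hat \<omega>)) (Sec (\<theta>hat \<omega>))"
    and shift: "\<And>\<omega>. \<omega> \<in> space M \<Longrightarrow> shift_compatible (A + B ** K) H (Sec (\<theta>hat \<omega>))"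
    and terminal: "\<And>\<omega>. \<omega> \<in> space M \<Longrightarrow>
      terminal_ingredients A B K X U H (Sec (\<theta>hat \<omega>)) (Xf (\<theta>hat \<omega>)) l lf"
    and F: "filtration (space M) F" "\<And>k. subalgebra M (F k)"
    and w_measurable: "\<And>k. w k \<in> borel_measurable M"
    and x_measurable: "\<And>k. k \<le> T \<Longrightarrow> x k \<in> borel_measurable (F k)"
    and u_measurable: "\<And>k. k < T \<Longrightarrow> u k \<in> borel_measurable (F (Suc k))"
    and dynamics: "\<And>k \<omega>. k < T \<Longrightarrow> \<omega> \<in> space M \<Longrightarrow> x (Suc k) \<omega> = A *v x k \<omega> + B *v u k \<omega> + w k \<omega>"
    and feasible: "\<And>k \<omega>. feasible k \<omega> \<longleftrightarrow>
      mpc_feasible A B K X U H (Sec (\<theta>hat \<omega>)) (Xf (\<theta>hat \<omega>)) (x k \<omega>)"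
    and feasible_measurable: "\<And>k. k \<le> T \<Longrightarrow> {\<omega> \<in> space M. feasible k \<omega>} \<in> sets M"
    and optimal: "\<And>k \<omega>. k < T \<Longrightarrow> \<omega> \<in> space M \<Longrightarrow> feasible k \<omega> \<Longrightarrow>
      mpc_optimal A B K X U H (Sec (\<theta>hat \<omega>)) (Xf (\<theta>hat \<omega>)) l lf (x k \<omega>)
        (\<lambda>t. zs k t \<omega>) (\<lambda>t. vs k t \<omega>)"
    and applied: "\<And>k \<omega>. k < T \<Longrightarrow> \<omega> \<in> space M \<Longrightarrow> feasible k \<omega> \<Longrightarrow> u k \<omega> = vs k 0 \<omega>"
    and zs_measurable: "\<And>k t. k < T \<Longrightarrow> t \<le> H \<Longrightarrow> zs k t \<in> borel_measurable M"
    and vs_measurable: "\<And>k t. k < T \<Longrightarrow> t < H \<Longrightarrow> vs k t \<in> borel_measurable M"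
    and e: "\<And>k t \<omega>. e k t \<omega> = pred_err (A + B ** K) (\<lambda>j. w j \<omega>) k t"
    and E: "\<And>k \<omega>. E k \<omega> = (\<lambda>t\<in>{1..H}. e k t \<omega>)"
    and failure: "\<And>k \<omega>. failure k \<omega> \<longleftrightarrow> feasible k \<omega> \<and>
      (\<not> horizon_safe K X U H (\<lambda>t. zs k t \<omega>) (\<lambda>t. vs k t \<omega>) (\<lambda>t. e k t \<omega>) \<or>
       \<not> feasible (Suc k) \<omega>)"
    and coverage: "\<And>k. k < T \<Longrightarrow> AE \<omega> in M. V \<omega> \<le> calib_eps N s \<beta> \<longrightarrow> feasible k \<omega> \<longrightarrow>
      cond_probability M (join_algebra (F k) \<sigma>SN) (\<lambda>\<omega>. E k \<omega> \<notin> Tube (\<theta>hat \<omega>)) \<omega>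
        \<le> calib_eps N s \<beta>"
  shows "AE \<omega> in M. V \<omega> \<le> calib_eps N s \<beta> \<longrightarrow>
    cond_probability M \<sigma>SN (\<lambda>\<omega>. \<exists>k<T. failure k \<omega>) \<omega> \<le> real T * calib_eps N s \<beta>"
proof -
  interpret prob_space M by (rule M)
  let ?eps = "calib_eps N s \<beta>"
  let ?PS = "\<Pi>\<^sub>M i\<in>{1..N}. (traj_space H :: (nat \<Rightarrow> real^'n) measure)"
  \<comment> \<open>Measurability is part of \<open>indep_vars\<close>; index 0 there is the fresh
    trajectory, so the calibration trajectories sit at the indices from 1 on.\<close>
  have D: "D i \<in> M \<rightarrow>\<^sub>M traj_space H" if "i \<in> {1..N}" for i
    using iid(1) that unfolding indep_vars_def by (auto dest!: bspec[where x=i])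
  have SN_meas: "SN \<in> M \<rightarrow>\<^sub>M ?PS"
    unfolding SN[abs_def] by (intro measurable_restrict D)
  have \<theta>_meas: "\<theta>hat \<in> M \<rightarrow>\<^sub>M \<Theta>"
    unfolding \<theta>hat[abs_def] by (rule measurable_compose[OF SN_meas calibrate])
  have sub: "subalgebra M \<sigma>SN"
    unfolding \<sigma>SN subalgebra_def
    using sets_image_in_sets[OF refl SN_meas] by simp
  note subJ = subalgebra_join[OF F(2) sub] and subJ' = subalgebra_join_right[OF F(2) sub]
  have e_meas: "e k t \<in> borel_measurable M" for k t
    unfolding e[abs_def] using w_measurable by (rule borel_measurable_pred_err)
  have E_meas: "E k \<in> M \<rightarrow>\<^sub>M traj_space H" for k
    unfolding E[abs_def] traj_space_def by (intro measurable_restrict e_meas)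
  define Bad where "Bad k = {\<omega> \<in> space M. E k \<omega> \<notin> Tube (\<theta>hat \<omega>)}" for k
  define Fail where "Fail k = {\<omega> \<in> space M. failure k \<omega>}" for k
  have Bad: "Bad k \<in> events" for k
  proof -
    \<comment> \<open>Both the tube and the trajectory are random; joint measurability of the tube
      relation makes the event a preimage under this pair.\<close>
    have pair: "(\<lambda>\<omega>. (\<theta>hat \<omega>, E k \<omega>)) \<in> M \<rightarrow>\<^sub>M \<Theta> \<Otimes>\<^sub>M traj_space H"
      using \<theta>_meas E_meas by (rule measurable_Pair)
    have "Bad k = space M - (\<lambda>\<omega>. (\<theta>hat \<omega>, E k \<omega>)) -`
        {(\<theta>, \<xi>) \<in> space (\<Theta> \<Otimes>\<^sub>M traj_space H). \<xi> \<in> Tube \<theta>} \<inter> space M"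
      using measurable_space[OF pair] by (auto simp: Bad_def)
    then show ?thesis using measurable_sets[OF pair Tube_measurable] by auto
  qed
  have Fail: "Fail k \<in> events" if "k < T" for k
  proof -
    have "{\<omega> \<in> space M. horizon_safe K X U H (\<lambda>t. zs k t \<omega>) (\<lambda>t. vs k t \<omega>) (\<lambda>t. e k t \<omega>)} \<in> events"
      using X U zs_measurable[OF that] vs_measurable[OF that] e_meas by (rule sets_horizon_safe)
    then show ?thesis
      unfolding Fail_def failure using feasible_measurable[of k] feasible_measurable[of "Suc k"] that
      by (intro sets.sets_Collect_conj sets.sets_Collect_disj sets.sets_Collect_neg) auto
  qed
  \<comment> \<open>The deterministic core, argued at a single sample point: staying in the tube
    excludes failure.\<close>
  have Fail_sub: "Fail k \<subseteq> Bad k \<inter> {\<omega>. feasible k \<omega>}" if k: "k < T" for k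
  proof
    fix \<omega> assume "\<omega> \<in> Fail k"
    then have \<omega>: "\<omega> \<in> space M" and fk: "feasible k \<omega>" and fail: "failure k \<omega>"
      by (auto simp: Fail_def failure)
    let ?S = "Sec (\<theta>hat \<omega>)"
    have "\<not> failure k \<omega>" if tube: "E k \<omega> \<in> Tube (\<theta>hat \<omega>)"
    proof -
      have adm: "mpc_admissible A B K X U H ?S (Xf (\<theta>hat \<omega>)) (x k \<omega>) (\<lambda>t. zs k t \<omega>) (\<lambda>t. vs k t \<omega>)"
        using optimal[OF k \<omega> fk] by (simp add: mpc_optimal_def)
      \<comment> \<open>At \<open>t = 0\<close> the section is \<open>{0}\<close> and the error
        starts at 0; later sections contain the projections of the tube.\<close>
      have err: "e k t \<omega> \<in> ?S t" if "t \<le> H" for t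
      proof (cases "t = 0")
        case True
        then show ?thesis using sections[OF \<omega>] by (simp add: cross_sections_def e)
      next
        case False
        then have "t \<in> {1..H}" using that by auto
        then have "E k \<omega> t \<in> ?S t" "E k \<omega> t = e k t \<omega>"
          using sections[OF \<omega>] tube unfolding cross_sections_def by (blast, simp add: E)
        then show ?thesis by simp
      qed
      \<comment> \<open>The error restarts from 0 at each update, so \<open>e k 1\<close> is just
        \<open>w k\<close>.\<close>
      have w: "w k \<omega> \<in> ?S 1" using err[of 1] H by (simp add: e)
      \<comment> \<open>The nominal plan starts at the measured state and its first input is the
        applied one, so state and prediction differ by the disturbance only.\<close>
      have "x (Suc k) \<omega> = zs k 1 \<omega> + w k \<omega>"
        using adm H dynamics[OF k \<omega>] applied[OF k \<omega> fk] by (simp add: mpc_admissible_def)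
      then have "feasible (Suc k) \<omega>"
        using mpc_feasible_shift[OF H adm terminal[OF \<omega>] shift[OF \<omega>] w] by (simp add: feasible)
      moreover have "horizon_safe K X U H (\<lambda>t. zs k t \<omega>) (\<lambda>t. vs k t \<omega>) (\<lambda>t. e k t \<omega>)"
        using adm terminal[OF \<omega>] err by (rule horizon_safe_if_in_sections)
      ultimately show ?thesis by (simp add: failure)
    qed
    then show "\<omega> \<in> Bad k \<inter> {\<omega>. feasible k \<omega>}" using \<omega> fk fail by (auto simp: Bad_def)
  qed
  \<comment> \<open>\<open>V\<close> is itself a conditional expectation given
    \<open>\<sigma>SN\<close>, so the calibration event is determined by the sample.\<close>
  have Q: "{\<omega> \<in> space M. V \<omega> \<le> ?eps} \<in> sets \<sigma>SN"
  proof -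
    have [measurable]: "V \<in> borel_measurable \<sigma>SN" by (simp add: V cond_probability_def)
    have "space \<sigma>SN = space M" using sub by (simp add: subalgebra_def)
    moreover have "{\<omega> \<in> space \<sigma>SN. V \<omega> \<le> ?eps} \<in> sets \<sigma>SN" by measurable
    ultimately show ?thesis by simp
  qed
  \<comment> \<open>Feasibility is only assumed to be an event of \<open>M\<close>, not of the
    joined algebra, so it plays the role of \<open>W\<close>, and the calibration event that of
    \<open>Q\<close>.\<close>
  have "AE \<omega> in M. V \<omega> \<le> ?eps \<longrightarrow> real_cond_exp M \<sigma>SN (indicator (Fail k)) \<omega> \<le> ?eps"
    if k: "k < T" for k
    using coverage[OF k] unfolding cond_probability_def Bad_def[symmetric]
    by (intro real_cond_exp_indicator_le[OF subJ subJ' Bad Fail[OF k] Fail_sub[OF k] Q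
          calib_eps_nonneg[OF s \<beta>(1)]]) simp
  then have "AE \<omega> in M. V \<omega> \<le> ?eps \<longrightarrow>
      real_cond_exp M \<sigma>SN (indicator (\<Union>k<T. Fail k)) \<omega> \<le> real T * ?eps"
    using sub Fail by (intro real_cond_exp_indicator_Union_le)
  moreover have "(\<Union>k<T. Fail k) = {\<omega> \<in> space M. \<exists>k<T. failure k \<omega>}" by (auto simp: Fail_def)
  ultimately show ?thesis by (simp add: cond_probability_def)
qed

end
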